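(* Let $R$ be a finite associative ring with identity $1$, and let $q=|R|$ be the number of elements of $R$. Let $r,s\in R$, consider the quadratic polynomial equation $x^2-rx+s=0$, and assume that this equation has two different roots $a,b\in R$ such that $a-b$ is not a right zero divisor. Then, for $n\in\mathbb{N}$, the total number of $n\times n$ upper triangular matrices $A$ over $R$ that satisfy the quadratic equation $A^2-rA+sI=0$, where $I$ is the identity matrix, is equal to $$\sum_{\substack{n_1+n_2=n\\ 0\le n_1,\,0\le n_2}}\binom{n}{n_1,n_2}\, q^{n_1n_2},$$ where $n_1,n_2$ are the numbers of times that $a,b$ appear on the diagonal, respectively.
   Context: Here $\binom{n}{n_1,n_2}=\dfrac{n!}{n_1!\,n_2!}$ is the multinomial coefficient, for integers $n_1,n_2\ge 0$ with $n_1+n_2=n$.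
   Formalization: The formal theorem assumes that a, b are the only roots and are central in R. Without centrality the claim fails: for R=M_2(F_2), r=s=1, n=2 there are 16 solutions, not 34. With more roots it fails at n=1 (x^2-1 over Z/15 has four roots). *)

theory Defs
  imports "Jordan_Normal_Form.Matrix"
begin

definition right_zero_divisor :: "'a::ring_1 \<Rightarrow> bool" where
  "right_zero_divisor x \<longleftrightarrow> (\<exists>y. y \<noteq> 0 \<and> y * x = 0)"

text \<open>For \<open>n\<^sub>1 + n\<^sub>2 = n\<close>, the only case used, the truncating division is exact.\<close>

definition multinomial2 :: "nat \<Rightarrow> nat \<Rightarrow> nat \<Rightarrow> nat" where
  "multinomial2 n n1 n2 = fact n div (fact n1 * fact n2)"

text \<open>The scalars \<open>r\<close> and \<open>s\<close> multiply entries from the left.\<close>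

definition ut_solutions :: "'a::ring_1 \<Rightarrow> 'a \<Rightarrow> nat \<Rightarrow> 'a mat set" where
  "ut_solutions r s n =
     {A \<in> carrier_mat n n. upper_triangular A \<and>
        A ^\<^sub>m 2 - r \<cdot>\<^sub>m A + s \<cdot>\<^sub>m 1\<^sub>m n = 0\<^sub>m n n}"

end

theory Submission
  imports Defs "HOL-Combinatorics.Multiset_Permutations"
begin

text \<open>
  Subtracting the equations for the two roots and cancelling \<open>a - b\<close> gives \<open>r = a + b\<close> and
  \<open>s = a b\<close>, and by finiteness \<open>a - b\<close> is a central unit. Bordering an upper triangular matrix
  \<open>B\<close> by a last column \<open>v\<close> and a corner entry \<open>c\<close> preserves the equation
  iff \<open>c\<close> is \<open>a\<close> or \<open>b\<close> and \<open>v\<close> is an eigenvector of \<open>B\<close> for the other root. The eigenspace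
  of a solution for a root has \<open>q ^ k\<close> elements, where \<open>k\<close> is the multiplicity of that root on
  the diagonal. Hence each diagonal with \<open>n\<^sub>1\<close> entries \<open>a\<close> and \<open>n\<^sub>2\<close> entries \<open>b\<close> belongs to
  \<open>q ^ (n\<^sub>1 n\<^sub>2)\<close> solutions.
\<close>

section \<open>Bordered matrices and eigenspaces\<close>

definition bordered :: "'a::zero mat \<Rightarrow> 'a vec \<Rightarrow> 'a \<Rightarrow> 'a mat" where
  "bordered B v c = (let n = dim_row B in
     mat (Suc n) (Suc n) (\<lambda>(i, j).
       if j < n then (if i < n then B $$ (i, j) else 0)
       else (if i < n then v $ i else c)))"

text \<open>Matrix and scalar act from the left, so this set is closed under multiplying vectors by
  ring elements from the right. Multiples of an eigenvector \<open>v\<close> occur below in the form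
  \<open>v $ i * x\<close>.\<close>

definition eigenspace :: "'a::semiring_0 mat \<Rightarrow> 'a \<Rightarrow> 'a vec set" where
  "eigenspace B c = {v \<in> carrier_vec (dim_row B). B *\<^sub>v v = c \<cdot>\<^sub>v v}"

lemma bordered_carrier [simp]:
  "B \<in> carrier_mat n n \<Longrightarrow> bordered B v c \<in> carrier_mat (Suc n) (Suc n)"
  by (auto simp: bordered_def Let_def)

lemma bordered_index:
  assumes "B \<in> carrier_mat n n" "i < Suc n" "j < Suc n"
  shows "bordered B v c $$ (i, j) =
    (if j < n then (if i < n then B $$ (i, j) else 0) else (if i < n then v $ i else c))"
  using assms by (auto simp: bordered_def Let_def)

lemma diag_mat_bordered:
  assumes "B \<in> carrier_mat n n"
  shows "diag_mat (bordered B v c) = diag_mat B @ [c]"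
proof -
  have "dim_row (bordered B v c) = Suc n" "dim_row B = n"
    by (rule carrier_matD(1), rule bordered_carrier[OF assms], rule carrier_matD(1)[OF assms])
  then show ?thesis
    using assms by (auto simp: diag_mat_def bordered_index)
qed

lemma bordered_inject:
  assumes "B \<in> carrier_mat n n" "B' \<in> carrier_mat n n" "v \<in> carrier_vec n" "v' \<in> carrier_vec n"
    and eq: "bordered B v c = bordered B' v' c'"
  shows "B = B' \<and> v = v' \<and> c = c'"
proof -
  have *: "bordered B v c $$ (i, j) = bordered B' v' c' $$ (i, j)" for i j
    using eq by simp
  have "B $$ (i, j) = B' $$ (i, j)" if "i < n" "j < n" for i j
    using *[of i j] assms(1,2) that by (simp add: bordered_index)
  moreover have "v $ i = v' $ i" if "i < n" for i
    using *[of i n] assms(1,2) that by (simp add: bordered_index)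
  moreover have "c = c'"
    using *[of n n] assms(1,2) by (simp add: bordered_index)
  ultimately show ?thesis
    using assms(1-4) by (auto intro!: eq_matI eq_vecI)
qed

text \<open>Peeling off the last row and column drives the inductions below. The diagonal then loses
  its last entry, which matches induction over lists from the right.\<close>

lemma upper_triangular_eq_bordered:
  assumes A: "A \<in> carrier_mat (Suc n) (Suc n)" and "upper_triangular A"
  obtains B v c where "B \<in> carrier_mat n n" "v \<in> carrier_vec n" "A = bordered B v c"
proof
  define B where "B = mat n n (\<lambda>(i, j). A $$ (i, j))"
  define v where "v = vec n (\<lambda>i. A $$ (i, n))"
  show B: "B \<in> carrier_mat n n" and v: "v \<in> carrier_vec n"
    by (auto simp: B_def v_def)
  show "A = bordered B v (A $$ (n, n))"
  proof (rule eq_matI)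
    fix i j assume "i < dim_row (bordered B v (A $$ (n, n)))" "j < dim_col (bordered B v (A $$ (n, n)))"
    then have ij: "i < Suc n" "j < Suc n"
      using bordered_carrier[OF B, of v "A $$ (n, n)"] by auto
    have "A $$ (n, j) = 0" if "j < n"
      using assms that by auto
    then show "A $$ (i, j) = bordered B v (A $$ (n, n)) $$ (i, j)"
      using ij by (auto simp: bordered_index[OF B]) (auto simp: B_def v_def less_Suc_eq)
  qed (use A bordered_carrier[OF B, of v "A $$ (n, n)"] in auto)
qed

lemma upper_triangular_bordered_iff:
  assumes B: "B \<in> carrier_mat n n"
  shows "upper_triangular (bordered B v c) \<longleftrightarrow> upper_triangular B"
proof -
  have "dim_row (bordered B v c) = Suc n" "dim_row B = n"
    by (rule carrier_matD(1), rule bordered_carrier[OF B], rule carrier_matD(1)[OF B])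
  then show ?thesis
    using B by (auto simp: upper_triangular_def bordered_index less_Suc_eq)
qed

lemma eigenspace_iff:
  assumes "B \<in> carrier_mat n n"
  shows "v \<in> eigenspace B c \<longleftrightarrow>
    v \<in> carrier_vec n \<and> (\<forall>i<n. (\<Sum>k<n. B $$ (i, k) * v $ k) = c * v $ i)"
proof -
  have "B *\<^sub>v v = c \<cdot>\<^sub>v v \<longleftrightarrow> (\<forall>i<n. (\<Sum>k<n. B $$ (i, k) * v $ k) = c * v $ i)"
    if v: "v \<in> carrier_vec n"
  proof -
    have "(B *\<^sub>v v) $ i = (\<Sum>k<n. B $$ (i, k) * v $ k)" if "i < n" for i
      using assms v that by (simp add: scalar_prod_def atLeast0LessThan)
    then show ?thesis
      using assms v unfolding vec_eq_iff by simp
  qed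
  then show ?thesis
    using assms by (auto simp: eigenspace_def)
qed

section \<open>The quadratic equation for a bordered matrix\<close>

lemma ut_solutions_iff:
  "A \<in> ut_solutions r s n \<longleftrightarrow> A \<in> carrier_mat n n \<and> upper_triangular A \<and>
     (\<forall>i<n. \<forall>j<n. (\<Sum>k<n. A $$ (i, k) * A $$ (k, j)) - r * A $$ (i, j)
        + (if i = j then s else 0) = 0)"
proof (cases "A \<in> carrier_mat n n")
  case True
  then have "A ^\<^sub>m 2 = A * A"
    by (simp add: numeral_2_eq_2)
  moreover have "(A * A) $$ (i, j) = (\<Sum>k<n. A $$ (i, k) * A $$ (k, j))" if "i < n" "j < n" for i j
    using True that by (simp add: scalar_prod_def atLeast0LessThan)
  ultimately show ?thesis
    using True by (simp add: ut_solutions_def mat_eq_iff)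
next
  case False
  then show ?thesis by (simp add: ut_solutions_def)
qed

text \<open>Read off block by block. The zero last row leaves the equation for \<open>B\<close> in
  the upper left block and makes the lower left block vanish; the last column gives the condition on
  \<open>v\<close>, the corner the scalar equation for \<open>c\<close>.\<close>

lemma bordered_mem_ut_solutions_iff:
  assumes B: "B \<in> carrier_mat n n"
  shows "bordered B v c \<in> ut_solutions r s (Suc n) \<longleftrightarrow>
    B \<in> ut_solutions r s n \<and> c * c - r * c + s = 0 \<and>
    (\<forall>i<n. (\<Sum>k<n. B $$ (i, k) * v $ k) + v $ i * c - r * v $ i = 0)"
proof -
  define M where "M = bordered B v c"
  have M: "M $$ (i, j) = B $$ (i, j)" "M $$ (i, n) = v $ i" "M $$ (n, j) = 0" "M $$ (n, n) = c"
    if "i < n" "j < n" for i j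
    using that by (simp_all add: M_def bordered_index[OF B])
  \<comment> \<open>For \<open>n = 0\<close> no index satisfies the premises of \<open>M\<close>, so
    the corner entry is also recorded without them.\<close>
  have Mnn: "M $$ (n, n) = c"
    by (simp add: M_def bordered_index[OF B])
  define eqn where "eqn A m i j \<longleftrightarrow> (\<Sum>k<m. A $$ (i, k) * A $$ (k, j)) - r * A $$ (i, j)
      + (if i = j then s else 0) = 0" for A m i j
  have "eqn M (Suc n) i j \<longleftrightarrow> eqn B n i j" if "i < n" "j < n" for i j
    using that by (simp add: eqn_def M)
  moreover have "eqn M (Suc n) i n \<longleftrightarrow> (\<Sum>k<n. B $$ (i, k) * v $ k) + v $ i * c - r * v $ i = 0"
    if "i < n" for i
    using that by (simp add: eqn_def M Mnn)
  moreover have "eqn M (Suc n) n j" if "j < n" for j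
    using that by (simp add: eqn_def M)
  moreover have "eqn M (Suc n) n n \<longleftrightarrow> c * c - r * c + s = 0"
    by (simp add: eqn_def M Mnn)
  ultimately have "(\<forall>i<Suc n. \<forall>j<Suc n. eqn M (Suc n) i j) \<longleftrightarrow>
      (\<forall>i<n. \<forall>j<n. eqn B n i j) \<and> c * c - r * c + s = 0 \<and>
      (\<forall>i<n. (\<Sum>k<n. B $$ (i, k) * v $ k) + v $ i * c - r * v $ i = 0)"
    by (auto simp: All_less_Suc)
  then show ?thesis
    unfolding ut_solutions_iff eqn_def[symmetric] M_def
    using B by (simp add: upper_triangular_bordered_iff)
qed

section \<open>Words in two letters\<close>

text \<open>These lists are the arrangements of a multiset with \<open>n1\<close> copies of
  \<open>a\<close> and \<open>n2\<close> copies of \<open>b\<close>; their number is the factorial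
  of its size over the factorials of the multiplicities.\<close>

lemma card_lists_count_two:
  assumes "a \<noteq> b"
  shows "card {xs. length xs = n1 + n2 \<and> set xs \<subseteq> {a, b} \<and> count_list xs a = n1 \<and> count_list xs b = n2} =
    multinomial2 (n1 + n2) n1 n2"
    and "finite {xs. length xs = n1 + n2 \<and> set xs \<subseteq> {a, b} \<and> count_list xs a = n1 \<and> count_list xs b = n2}"
proof -
  define M where "M = replicate_mset n1 a + replicate_mset n2 b"
  have cM: "count M x = (if x = a then n1 else if x = b then n2 else 0)" for x
    using assms by (auto simp: M_def)
  have "{xs. length xs = n1 + n2 \<and> set xs \<subseteq> {a, b} \<and> count_list xs a = n1 \<and> count_list xs b = n2} =
    permutations_of_multiset M" (is "?L = _")
  proof (intro subset_antisym subsetI)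
    fix xs assume xs: "xs \<in> ?L"
    then have "count (mset xs) x = count M x" for x
      by (cases "x \<in> {a, b}") (auto simp: cM count_mset count_list_0_iff)
    then show "xs \<in> permutations_of_multiset M"
      by (auto simp: permutations_of_multiset_def intro: multiset_eqI)
  next
    fix xs assume "xs \<in> permutations_of_multiset M"
    then have m: "mset xs = M" by (simp add: permutations_of_multiset_def)
    have "set xs = set_mset M" using m by auto
    moreover have "length xs = size M" using m by auto
    moreover have "count_list xs x = count M x" for x
      using m by (auto simp: count_mset)
    ultimately show "xs \<in> ?L"
      using assms by (auto simp: cM) (auto simp: M_def split: if_splits)
  qed
  \<comment> \<open>If \<open>n1\<close> or \<open>n2\<close> is 0, that letter is missing from
    \<open>set_mset M\<close>, but its factor would be \<open>fact 0 = 1\<close>.\<close>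
  moreover have "(\<Prod>x\<in>set_mset M. fact (count M x)) = (\<Prod>x\<in>{a, b}. fact (count M x) :: nat)"
    by (rule prod.mono_neutral_left) (auto simp: cM not_in_iff, auto simp: M_def split: if_splits)
  moreover have "size M = n1 + n2" by (simp add: M_def)
  ultimately show "card ?L = multinomial2 (n1 + n2) n1 n2" "finite ?L"
    using assms by (simp_all add: card_permutations_of_multiset multinomial2_def cM)
qed

section \<open>Eigenspaces of solutions for two central roots\<close>

text \<open>\<open>diff_roots\<close> is an assumption of its own: with zero divisors, the quadratic
  may have further roots even when \<open>a - b\<close> is a unit. Modulo 6, for instance,
  \<open>x * x - x\<close> vanishes at 0, 1, 3 and 4.\<close>

locale central_pair =
  fixes a b e :: "'a :: {ring_1, finite}"
  assumes a_central: "a * x = x * a"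
    and b_central: "b * x = x * b"
    and e_central: "e * x = x * e"
    and inverse_diff: "e * (a - b) = 1"
    and diff_roots: "x * x - (a + b) * x + a * b = 0 \<Longrightarrow> x = a \<or> x = b"
begin

text \<open>The assumptions are symmetric up to the sign of \<open>e\<close>, so results about the
  root \<open>a\<close> carry over to \<open>b\<close>.\<close>

lemma swap: "central_pair b a (- e)"
proof
  show "- e * (b - a) = 1" using inverse_diff by (simp add: algebra_simps)
  show "x * x - (b + a) * x + b * a = 0 \<Longrightarrow> x = b \<or> x = a" for x
    using diff_roots[of x] by (auto simp: add.commute a_central[of b])
qed (simp_all add: a_central b_central e_central)

lemma card_ring_pos [simp]: "card (UNIV :: 'a set) > 0"
  by (simp add: finite_UNIV_card_ge_0)

lemma a_neq_b: "a \<noteq> b"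
  using inverse_diff by auto

lemma a_times_eq_b_times: "a * x = b * x \<longleftrightarrow> x = 0"
proof
  assume "a * x = b * x"
  then have "e * ((a - b) * x) = 0" by (simp add: left_diff_distrib)
  then show "x = 0" by (simp add: inverse_diff flip: mult.assoc)
qed simp

lemma root_iff: "c * c - (a + b) * c + a * b = 0 \<longleftrightarrow> c = a \<or> c = b"
  using diff_roots[of c] by (auto simp: algebra_simps a_central[of b])

text \<open>For \<open>c = a\<close> the terms \<open>v $ i * a\<close> and \<open>a * v $ i\<close>
  cancel because \<open>a\<close> is central, and the column condition becomes
  \<open>B v = b v\<close>; likewise with the roots exchanged.\<close>

lemma bordered_solution_iff:
  assumes B: "B \<in> carrier_mat n n" and v: "v \<in> carrier_vec n"
  shows "bordered B v c \<in> ut_solutions (a + b) (a * b) (Suc n) \<longleftrightarrow>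
    B \<in> ut_solutions (a + b) (a * b) n \<and>
    (c = a \<and> v \<in> eigenspace B b \<or> c = b \<and> v \<in> eigenspace B a)"
proof -
  have "y + x * a - (a + b) * x = 0 \<longleftrightarrow> y = b * x" "y + x * b - (a + b) * x = 0 \<longleftrightarrow> y = a * x" for x y
    by (auto simp: algebra_simps simp flip: a_central b_central)
  then show ?thesis
    unfolding bordered_mem_ut_solutions_iff[OF B] root_iff eigenspace_iff[OF B]
    using v by auto
qed

text \<open>An eigenvector of the bordered matrix consists of \<open>w\<close> and a last entry
  \<open>x\<close> with \<open>B w + v x = a w\<close> and \<open>c x = a x\<close>. If
  \<open>c = b\<close>, then \<open>x = 0\<close> and \<open>w\<close> is an eigenvector of
  \<open>B\<close>. If \<open>c = a\<close>, then \<open>x\<close> is free and \<open>w\<close>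
  ranges over a translate of the eigenspace of \<open>B\<close>, which contributes one more factor
  \<open>q\<close>.\<close>

lemma card_eigenspace:
  assumes "B \<in> ut_solutions (a + b) (a * b) n"
  shows "card (eigenspace B a) = card (UNIV :: 'a set) ^ count_list (diag_mat B) a"
  using assms
proof (induction n arbitrary: B)
  case 0
  then have "B \<in> carrier_mat 0 0" by (simp add: ut_solutions_def)
  then have "eigenspace B a = {vNil}" "diag_mat B = []"
    by (auto simp: eigenspace_iff diag_mat_def)
  then show ?case by simp
next
  case (Suc n A)
  then have A: "A \<in> carrier_mat (Suc n) (Suc n)" "upper_triangular A"
    by (auto simp: ut_solutions_def)
  then obtain B v c where B: "B \<in> carrier_mat n n" and v: "v \<in> carrier_vec n"
    and A_eq: "A = bordered B v c"
    using upper_triangular_eq_bordered by metis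
  have sol: "B \<in> ut_solutions (a + b) (a * b) n"
    and cases: "c = a \<and> v \<in> eigenspace B b \<or> c = b \<and> v \<in> eigenspace B a"
    using Suc.prems bordered_solution_iff[OF B v] by (auto simp: A_eq)
  have diag: "diag_mat A = diag_mat B @ [c]"
    by (simp add: A_eq diag_mat_bordered[OF B])
  have IH: "card (eigenspace B a) = card (UNIV :: 'a set) ^ count_list (diag_mat B) a"
    by (rule Suc.IH[OF sol])
  have eig_iff: "u \<in> eigenspace A a \<longleftrightarrow> u \<in> carrier_vec (Suc n) \<and>
      (\<forall>i<n. (\<Sum>k<n. B $$ (i, k) * u $ k) + v $ i * u $ n = a * u $ i) \<and> c * u $ n = a * u $ n" for u
    unfolding eigenspace_iff[OF A(1)]
    using B by (auto simp: A_eq bordered_index less_Suc_eq cong: sum.cong_simp)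
  \<comment> \<open>Both cases parametrize the eigenspace of \<open>A\<close> by an eigenvector
    \<open>w\<close> of \<open>B\<close> and the last entry \<open>x\<close>. For
    \<open>c = b\<close> take \<open>t = 0\<close> and \<open>x = 0\<close>; for
    \<open>c = a\<close> take \<open>t = e\<close>, which adds a particular solution.\<close>
  define g where "g t = (\<lambda>(w, x). vec (Suc n) (\<lambda>i. if i < n then w $ i + t * (v $ i * x) else x))"
    for t :: 'a
  have inj: "inj_on (g t) (eigenspace B a \<times> X)" for t X
  proof (rule inj_onI, clarify)
    fix w x w' x' assume ww: "w \<in> eigenspace B a" "w' \<in> eigenspace B a" and g: "g t (w, x) = g t (w', x')"
    have "g t (w, x) $ i = g t (w', x') $ i" for i by (simp add: g)
    from this[of n] have x: "x = x'" by (simp add: g_def)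
    have "w $ i = w' $ i" if "i < n" for i
      using arg_cong[OF g, of "\<lambda>u. u $ i"] x that by (simp add: g_def)
    then show "w = w' \<and> x = x'"
      using x ww by (auto simp: eigenspace_iff[OF B] intro!: eq_vecI)
  qed
  from cases show ?case
  proof (elim disjE conjE)
    assume c: "c = b" 
    have "eigenspace A a = g 0 ` (eigenspace B a \<times> {0})"
    proof (intro subset_antisym subsetI)
      fix u assume u: "u \<in> eigenspace A a"
      then have un: "u $ n = 0" using a_times_eq_b_times[of "u $ n"] by (simp add: eig_iff c)
      have "u = g 0 (vec n (\<lambda>i. u $ i), 0)"
        using u un by (auto simp: g_def eig_iff less_Suc_eq intro!: eq_vecI)
      moreover have "vec n (\<lambda>i. u $ i) \<in> eigenspace B a"
        using u un by (auto simp: eig_iff eigenspace_iff[OF B])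
      ultimately show "u \<in> g 0 ` (eigenspace B a \<times> {0})" by blast
    next
      fix u assume "u \<in> g 0 ` (eigenspace B a \<times> {0})"
      then show "u \<in> eigenspace A a"
        by (auto simp: eig_iff eigenspace_iff[OF B] g_def)
    qed
    then show ?thesis
      using a_neq_b by (simp add: card_image[OF inj] IH diag c card_cartesian_product)
  next
    assume c: "c = a" and vb: "v \<in> eigenspace B b"
    text \<open>Since \<open>B v = b v\<close>, the vector \<open>e v x\<close> is a particular solution \<open>w\<close>
      of \<open>(B - a) w = - v x\<close>.\<close>
    have particular: "(\<Sum>k<n. B $$ (i, k) * (w $ k + e * (v $ k * x))) + v $ i * x - a * (w $ i + e * (v $ i * x))
        = (\<Sum>k<n. B $$ (i, k) * w $ k) - a * w $ i" if i: "i < n" for w i x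
    proof -
      have "(\<Sum>k<n. B $$ (i, k) * (e * (v $ k * x))) = e * ((\<Sum>k<n. B $$ (i, k) * v $ k) * x)"
        unfolding sum_distrib_left sum_distrib_right
        by (rule sum.cong) (simp, metis e_central mult.assoc)
      also have "\<dots> = e * (b * (v $ i * x))"
        using vb i by (simp add: eigenspace_iff[OF B] mult.assoc)
      \<comment> \<open>Writing \<open>b = a - (a - b)\<close> brings in the product
        \<open>e * (a - b)\<close>, which is 1.\<close>
      also have "\<dots> = e * (a * (v $ i * x)) - e * (a - b) * (v $ i * x)"
        by (simp add: algebra_simps)
      also have "\<dots> = a * (e * (v $ i * x)) - v $ i * x"
        by (simp add: inverse_diff a_central[of e] flip: mult.assoc)
      finally show ?thesis
        by (simp add: distrib_left sum.distrib)
    qed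
    have "eigenspace A a = g e ` (eigenspace B a \<times> UNIV)"
    proof (intro subset_antisym subsetI)
      fix u assume u: "u \<in> eigenspace A a"
      \<comment> \<open>Subtracting the particular solution for the last entry of \<open>u\<close>
        leaves a solution of the homogeneous system.\<close>
      define w where "w = vec n (\<lambda>i. u $ i - e * (v $ i * u $ n))"
      have wu: "w $ i + e * (v $ i * u $ n) = u $ i" if "i < n" for i
        using that by (simp add: w_def)
      have "u = g e (w, u $ n)"
        using u wu by (auto simp: g_def eig_iff less_Suc_eq intro!: eq_vecI)
      moreover have "(\<Sum>k<n. B $$ (i, k) * w $ k) - a * w $ i = 0" if "i < n" for i
        using u that particular[OF that, of w "u $ n"]
        by (simp add: eig_iff wu cong: sum.cong_simp)
      then have "w \<in> eigenspace B a"
        by (auto simp: eigenspace_iff[OF B] w_def)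
      ultimately show "u \<in> g e ` (eigenspace B a \<times> UNIV)" by blast
    next
      fix u assume "u \<in> g e ` (eigenspace B a \<times> UNIV)"
      then obtain w x where u: "u = g e (w, x)" and w: "w \<in> eigenspace B a" by auto
      have "(\<Sum>k<n. B $$ (i, k) * (w $ k + e * (v $ k * x))) + v $ i * x = a * (w $ i + e * (v $ i * x))"
        if "i < n" for i
        using particular[OF that, of w x] w that by (simp add: eigenspace_iff[OF B])
      then show "u \<in> eigenspace A a"
        by (simp add: eig_iff u g_def c)
    qed
    then show ?thesis
      by (simp add: card_image[OF inj] IH diag c card_cartesian_product)
  qed
qed

lemma card_eigenspace':
  assumes "B \<in> ut_solutions (a + b) (a * b) n"
  shows "card (eigenspace B b) = card (UNIV :: 'a set) ^ count_list (diag_mat B) b"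
  using central_pair.card_eigenspace[OF swap, of B n] assms
  by (simp add: add.commute a_central[of b])

text \<open>By \<open>bordered_solution_iff\<close> the corner entry is a root and the remaining
  block is again a solution, so induction applies.\<close>

lemma diag_solution:
  assumes "A \<in> ut_solutions (a + b) (a * b) n"
  shows "length (diag_mat A) = n" "set (diag_mat A) \<subseteq> {a, b}"
  using assms
proof (induction n arbitrary: A)
  case 0
  { case 1 then show ?case by (auto simp: ut_solutions_def diag_mat_def) next
    case 2 then show ?case by (auto simp: ut_solutions_def diag_mat_def) }
next
  case (Suc n)
  have "length (diag_mat A) = Suc n \<and> set (diag_mat A) \<subseteq> {a, b}"
    if "A \<in> ut_solutions (a + b) (a * b) (Suc n)" for A
  proof -
    have "A \<in> carrier_mat (Suc n) (Suc n)" "upper_triangular A"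
      using that by (auto simp: ut_solutions_def)
    then obtain B v c where B: "B \<in> carrier_mat n n" and v: "v \<in> carrier_vec n"
      and A_eq: "A = bordered B v c"
      using upper_triangular_eq_bordered by metis
    then show ?thesis
      using that bordered_solution_iff[OF B v] Suc.IH[of B] 
      by (auto simp: diag_mat_bordered[OF B])
  qed
  then show "A \<in> ut_solutions (a + b) (a * b) (Suc n) \<Longrightarrow> length (diag_mat A) = Suc n"
    "A \<in> ut_solutions (a + b) (a * b) (Suc n) \<Longrightarrow> set (diag_mat A) \<subseteq> {a, b}" for A
    by auto
qed

section \<open>Counting solutions by their diagonal\<close>

text \<open>Appending \<open>c\<close> to the diagonal multiplies the count by the size of the
  eigenspace for the other root, that is by \<open>q\<close> to the number of earlier entries
  different from \<open>c\<close>. The total exponent is thus the number of pairs of positions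
  carrying different roots.\<close>

lemma card_solutions_diag:
  assumes "set xs \<subseteq> {a, b}"
  shows "card {A \<in> ut_solutions (a + b) (a * b) (length xs). diag_mat A = xs} =
    card (UNIV :: 'a set) ^ (count_list xs a * count_list xs b)"
  using assms
proof (induction xs rule: rev_induct)
  case Nil
  have "{A \<in> ut_solutions (a + b) (a * b) 0. diag_mat A = []} = {0\<^sub>m 0 0}"
    by (auto simp: ut_solutions_iff diag_mat_def)
  then show ?case by simp
next
  case (snoc c xs)
  let ?S = "ut_solutions (a + b) (a * b)"
  let ?c' = "if c = a then b else a"
  let ?X = "{B \<in> ?S (length xs). diag_mat B = xs}"
  let ?Y = "Sigma ?X (\<lambda>B. eigenspace B ?c')"
  have c: "c = a \<or> c = b" using snoc.prems by auto
  have IH: "card ?X = card (UNIV :: 'a set) ^ (count_list xs a * count_list xs b)"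
    using snoc by simp
  \<comment> \<open>An infinite set has \<open>card\<close> 0, so a positive count yields
    finiteness.\<close>
  then have fin: "finite ?X" by (intro card_ge_0_finite) simp
  have "{A \<in> ?S (length (xs @ [c])). diag_mat A = xs @ [c]} = (\<lambda>(B, v). bordered B v c) ` ?Y"
  proof (intro subset_antisym subsetI)
    fix A assume A: "A \<in> {A \<in> ?S (length (xs @ [c])). diag_mat A = xs @ [c]}"
    then have "A \<in> carrier_mat (Suc (length xs)) (Suc (length xs))" "upper_triangular A"
      by (auto simp: ut_solutions_def)
    then obtain B v c' where B: "B \<in> carrier_mat (length xs) (length xs)"
      and v: "v \<in> carrier_vec (length xs)" and A_eq: "A = bordered B v c'"
      using upper_triangular_eq_bordered by metis
    have "(B, v) \<in> ?Y \<and> c' = c"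
      using A bordered_solution_iff[OF B v] a_neq_b by (auto simp: A_eq diag_mat_bordered[OF B])
    then show "A \<in> (\<lambda>(B, v). bordered B v c) ` ?Y" using A_eq by force
  next
    fix A assume "A \<in> (\<lambda>(B, v). bordered B v c) ` ?Y"
    then obtain B v where B: "B \<in> ?S (length xs)" "diag_mat B = xs" and v: "v \<in> eigenspace B ?c'"
      and A_eq: "A = bordered B v c" by auto
    have Bc: "B \<in> carrier_mat (length xs) (length xs)" using B by (simp add: ut_solutions_def)
    have vc: "v \<in> carrier_vec (length xs)" using v by (simp add: eigenspace_iff[OF Bc])
    have "c = a \<and> v \<in> eigenspace B b \<or> c = b \<and> v \<in> eigenspace B a"
      using v c by (cases "c = a") simp_all
    then have "bordered B v c \<in> ?S (Suc (length xs))"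
      using B(1) bordered_solution_iff[OF Bc vc, of c] by blast
    then show "A \<in> {A \<in> ?S (length (xs @ [c])). diag_mat A = xs @ [c]}"
      by (simp add: A_eq diag_mat_bordered[OF Bc] B(2))
  qed
  moreover have "inj_on (\<lambda>(B, v). bordered B v c) ?Y"
  proof (rule inj_onI)
    fix p p' assume p: "p \<in> ?Y" "p' \<in> ?Y" and eq: "(\<lambda>(B, v). bordered B v c) p = (\<lambda>(B, v). bordered B v c) p'"
    obtain B v B' v' where [simp]: "p = (B, v)" "p' = (B', v')" by (cases p, cases p')
    have B: "B \<in> carrier_mat (length xs) (length xs)" "B' \<in> carrier_mat (length xs) (length xs)"
      using p by (simp_all add: ut_solutions_def)
    have v: "v \<in> carrier_vec (length xs)" "v' \<in> carrier_vec (length xs)"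
      using p eigenspace_iff[OF B(1)] eigenspace_iff[OF B(2)] by (simp_all only: \<open>p = _\<close> \<open>p' = _\<close> mem_Sigma_iff)
    show "p = p'"
      using bordered_inject[OF B v, of c c] eq by simp
  qed
  ultimately have "card {A \<in> ?S (length (xs @ [c])). diag_mat A = xs @ [c]} = card ?Y"
    by (simp add: card_image)
  also have "\<dots> = (\<Sum>B\<in>?X. card (eigenspace B ?c'))"
  proof (rule card_SigmaI[OF fin], rule ballI)
    fix B assume "B \<in> ?X"
    then have "card (eigenspace B ?c') > 0"
      using card_eigenspace[of B "length xs"] card_eigenspace'[of B "length xs"] by simp
    then show "finite (eigenspace B ?c')" by (rule card_ge_0_finite)
  qed
  also have "\<dots> = (\<Sum>B\<in>?X. card (UNIV :: 'a set) ^ count_list xs ?c')"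
    by (rule sum.cong[OF refl]) (simp add: card_eigenspace[of _ "length xs"] card_eigenspace'[of _ "length xs"])
  also have "\<dots> = card (UNIV :: 'a set) ^ (count_list xs a * count_list xs b) * card (UNIV :: 'a set) ^ count_list xs ?c'"
    by (simp add: IH)
  also have "\<dots> = card (UNIV :: 'a set) ^ (count_list (xs @ [c]) a * count_list (xs @ [c]) b)"
    using c a_neq_b by (auto simp: algebra_simps simp flip: power_add)
  finally show ?case .
qed

text \<open>There are finitely many possible diagonals, and the solutions with a given one have
  positive, hence finite, cardinality.\<close>

lemma finite_solutions: "finite (ut_solutions (a + b) (a * b) n)"
proof (rule finite_subset)
  let ?L = "{xs. set xs \<subseteq> {a, b} \<and> length xs = n}"
  show "ut_solutions (a + b) (a * b) n \<subseteq>
    (\<Union>xs\<in>?L. {A \<in> ut_solutions (a + b) (a * b) (length xs). diag_mat A = xs})"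
    using diag_solution by auto
  show "finite \<dots>"
  proof (rule finite_UN_I)
    show "finite ?L" by (rule finite_lists_length_eq) simp
  qed (auto intro!: card_ge_0_finite simp: card_solutions_diag)
qed

text \<open>Solutions are sorted by their whole diagonal: it is one of the words counted by
  \<open>card_lists_count_two\<close>, and each such word belongs to equally many solutions.\<close>

lemma card_solutions_count:
  "card {A \<in> ut_solutions (a + b) (a * b) (n1 + n2).
      count_list (diag_mat A) a = n1 \<and> count_list (diag_mat A) b = n2} =
    multinomial2 (n1 + n2) n1 n2 * card (UNIV :: 'a set) ^ (n1 * n2)"
proof -
  let ?S = "ut_solutions (a + b) (a * b) (n1 + n2)"
  let ?L = "{xs. length xs = n1 + n2 \<and> set xs \<subseteq> {a, b} \<and> count_list xs a = n1 \<and> count_list xs b = n2}"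
  have "{A \<in> ?S. count_list (diag_mat A) a = n1 \<and> count_list (diag_mat A) b = n2} =
      (\<Union>xs\<in>?L. {A \<in> ?S. diag_mat A = xs})"
  proof (intro subset_antisym subsetI)
    fix A assume "A \<in> {A \<in> ?S. count_list (diag_mat A) a = n1 \<and> count_list (diag_mat A) b = n2}"
    then show "A \<in> (\<Union>xs\<in>?L. {A \<in> ?S. diag_mat A = xs})"
      using diag_solution[of A "n1 + n2"] by simp
  qed blast
  also have "card \<dots> = (\<Sum>xs\<in>?L. card {A \<in> ?S. diag_mat A = xs})"
    by (rule card_UN_disjoint[OF card_lists_count_two(2)[OF a_neq_b]]) (use finite_solutions in auto)
  also have "\<dots> = (\<Sum>xs\<in>?L. card (UNIV :: 'a set) ^ (n1 * n2))"
  proof (rule sum.cong[OF refl])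
    fix xs assume "xs \<in> ?L"
    then show "card {A \<in> ?S. diag_mat A = xs} = card (UNIV :: 'a set) ^ (n1 * n2)"
      using card_solutions_diag[of xs] by simp
  qed
  finally show ?thesis
    by (simp add: card_lists_count_two(1)[OF a_neq_b])
qed

end

section \<open>From the given roots to a central pair\<close>

lemma count_list_two:
  assumes "a \<noteq> b" "set xs \<subseteq> {a, b}"
  shows "count_list xs a + count_list xs b = length xs"
  using assms by (induction xs) auto

theorem theorem1p2:
  fixes r s a b :: "'a :: {ring_1, finite}" and n :: nat
  assumes roots: "{x. x ^ 2 - r * x + s = 0} = {a, b}"
    and different: "a \<noteq> b"
    and not_rzd: "\<not> right_zero_divisor (a - b)"
    and central: "\<forall>x. a * x = x * a" "\<forall>x. b * x = x * b"
  shows "card (ut_solutions r s n) =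
           (\<Sum>(n1, n2) \<in> {(n1, n2). n1 + n2 = n}.
              multinomial2 n n1 n2 * card (UNIV :: 'a set) ^ (n1 * n2))
       \<and> (\<forall>n1 n2. n1 + n2 = n \<longrightarrow>
            card {A \<in> ut_solutions r s n.
                    count_list (diag_mat A) a = n1 \<and> count_list (diag_mat A) b = n2} =
              multinomial2 n n1 n2 * card (UNIV :: 'a set) ^ (n1 * n2))"
proof -
  have cancel: "y = 0" if "y * (a - b) = 0" for y
    using not_rzd that by (auto simp: right_zero_divisor_def)
  have ra: "a * a - r * a + s = 0" and rb: "b * b - r * b + s = 0"
    using roots by (auto simp: power2_eq_square)
  \<comment> \<open>Since \<open>a\<close> commutes with \<open>b\<close>, the mixed products cancel
    and only the difference of the two root equations remains.\<close>
  have "(a + b - r) * (a - b) = (a * a - r * a + s) - (b * b - r * b + s)"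
    using central(1)[rule_format, of b] by (simp add: algebra_simps)
  then have "a + b - r = 0"
    by (intro cancel[of "a + b - r"]) (simp add: ra rb)
  then have r: "r = a + b" by (simp add: algebra_simps)
  have s: "s = a * b"
    using ra central(1)[rule_format, of b] by (simp add: r algebra_simps eq_neg_iff_add_eq_0)
  \<comment> \<open>On a finite ring this injective map is onto, and a preimage of 1 is a left
    inverse of \<open>a - b\<close>.\<close>
  have "inj (\<lambda>y. y * (a - b))"
  proof (rule injI)
    fix x y assume "x * (a - b) = y * (a - b)"
    then have "(x - y) * (a - b) = 0" by (simp add: left_diff_distrib)
    then show "x = y" using cancel[of "x - y"] by simp
  qed
  then have "surj (\<lambda>y. y * (a - b))"
    by (simp add: finite_UNIV_inj_surj)
  then obtain e where e: "e * (a - b) = 1" by (metis surjD)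
  have d: "(a - b) * x = x * (a - b)" for x
    using central by (simp add: algebra_simps)
  have e_central: "e * x = x * e" for x
  proof -
    \<comment> \<open>Moving the central factor \<open>a - b\<close> next to \<open>e\<close> in
      both products turns each of them into \<open>x\<close>.\<close>
    have "(e * x - x * e) * (a - b) = e * (x * (a - b)) - x * (e * (a - b))"
      by (simp add: left_diff_distrib mult.assoc)
    also have "\<dots> = (e * (a - b)) * x - x * (e * (a - b))"
      by (simp only: d[of x, symmetric] mult.assoc)
    also have "\<dots> = 0"
      by (simp add: e)
    finally show ?thesis using cancel by force
  qed
  interpret central_pair a b e
  proof
    show "x = a \<or> x = b" if "x * x - (a + b) * x + a * b = 0" for x
      using roots that by (auto simp: r s power2_eq_square)
  qed (use central e_central e in blast)+
  let ?S = "ut_solutions r s n"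
  let ?T = "\<lambda>(n1, n2). {A \<in> ?S. count_list (diag_mat A) a = n1 \<and> count_list (diag_mat A) b = n2}"
  let ?P = "{(n1, n2). n1 + n2 = n}"
  have T: "card (?T (n1, n2)) = multinomial2 n n1 n2 * card (UNIV :: 'a set) ^ (n1 * n2)" if "n1 + n2 = n" for n1 n2
    using card_solutions_count[of n1 n2] that by (simp add: r s)
  have "finite ?P"
    by (rule finite_subset[of _ "{..n} \<times> {..n}"]) auto
  \<comment> \<open>The diagonal of a solution has \<open>n\<close> entries, all equal to
    \<open>a\<close> or \<open>b\<close>, so the classes \<open>?T\<close> cover
    \<open>?S\<close>.\<close>
  have "n1 + n2 = n" if "A \<in> ?S" "count_list (diag_mat A) a = n1" "count_list (diag_mat A) b = n2" for A n1 n2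
    using that diag_solution[of A n] count_list_two[OF different, of "diag_mat A"] by (simp add: r s)
  then have "?S = (\<Union>p\<in>?P. ?T p)"
    by blast
  also have "card \<dots> = (\<Sum>p\<in>?P. card (?T p))"
    by (rule card_UN_disjoint) (use \<open>finite ?P\<close> finite_solutions in \<open>auto simp: r s\<close>)
  also have "\<dots> = (\<Sum>(n1, n2)\<in>?P. multinomial2 n n1 n2 * card (UNIV :: 'a set) ^ (n1 * n2))"
    by (rule sum.cong) (use T in auto)
  finally show ?thesis
    using T by auto
qed

end
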